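(* Let $L'$ and $L''$ be two $\mathfrak{gl}(n)$-valued Lax operators with the same Tyurin parameters $\{(\alpha_s,\gamma_s)\}$, i.e. $\mathfrak{gl}(n)$-valued meromorphic functions on $\Gamma$, holomorphic outside $P_\pm$ and the points $\gamma_s$, which at every $\gamma_s$ satisfy: the function has at most a simple pole, its residue coefficient is of the form $\alpha_s\beta_s^t$ with $\beta_s^t\alpha_s=0$, and $\alpha_s$ is an eigenvector of its degree-zero Laurent coefficient. Then the pointwise product $L=L'L''$ satisfies the same conditions at every $\gamma_s$ (with the same $\alpha_s$).
   Context: $\Gamma$ is a compact Riemann surface (algebraic curve) of genus $g$ with two distinct marked points $P_+,P_-$. Fix further distinct points $\gamma_s\in\Gamma\setminus\{P_+,P_-\}$, $s=1,\ldots,ng$ (weak singularities), and nonzero vectors $\alpha_s\in\mathbb{C}^n$; the pairs $(\alpha_s,\gamma_s)$ are called Tyurin parameters. Let $z$ be a local coordinate near $\gamma_s$ and $z_s=z(\gamma_s)$. A $\mathfrak{gl}(n)$-valued Lax operator is a meromorphic function $L:\Gamma\to\mathfrak{gl}(n)=\mathrm{Mat}_n(\mathbb{C})$, holomorphic outside $P_\pm$ and the $\gamma_s$ (poles of arbitrary finite order are allowed at $P_\pm$), such that at every $\gamma_s$ $$L=\frac{L_{s,-1}}{z-z_s}+L_{s0}+O(z-z_s),$$ where (i) $L_{s,-1}=\alpha_s\beta_s^t$ for some $\beta_s\in\mathbb{C}^n$ (depending on $L$) with $\operatorname{tr}L_{s,-1}=\beta_s^t\alpha_s=0$; (ii) $L_{s0}\alpha_s=k_s\alpha_s$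 for some $k_s\in\mathbb{C}$. The superscript $t$ denotes transposition. *)

theory Defs
  imports "HOL-Complex_Analysis.Complex_Analysis" "HOL-Homology.Homology"
begin

type_synonym 'p chart = "'p set \<times> ('p \<Rightarrow> complex)"

definition complex_chart :: "'p topology \<Rightarrow> 'p chart \<Rightarrow> bool" where
  "complex_chart X c \<longleftrightarrow> (case c of (U, \<phi>) \<Rightarrow>
     openin X U \<and> open (\<phi> ` U) \<and>
     homeomorphic_map (subtopology X U) (top_of_set (\<phi> ` U)) \<phi>)"

definition holomorphically_compatible :: "'p chart \<Rightarrow> 'p chart \<Rightarrow> bool" where
  "holomorphically_compatible c d \<longleftrightarrow> (case (c, d) of ((U, \<phi>), (V, \<psi>)) \<Rightarrow>
     (\<psi> \<circ> inv_into U \<phi>) holomorphic_on \<phi> ` (U \<inter> V) \<and>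
     (\<phi> \<circ> inv_into V \<psi>) holomorphic_on \<psi> ` (U \<inter> V))"

definition complex_atlas :: "'p topology \<Rightarrow> 'p chart set \<Rightarrow> bool" where
  "complex_atlas X \<A> \<longleftrightarrow>
     (\<forall>c\<in>\<A>. complex_chart X c) \<and>
     (\<Union>c\<in>\<A>. fst c) = topspace X \<and>
     (\<forall>c\<in>\<A>. \<forall>d\<in>\<A>. holomorphically_compatible c d)"

definition compact_riemann_surface :: "'p topology \<Rightarrow> 'p chart set \<Rightarrow> bool" where
  "compact_riemann_surface X \<A> \<longleftrightarrow>
     topspace X \<noteq> {} \<and> Hausdorff_space X \<and> connected_space X \<and> compact_space X \<and>
     complex_atlas X \<A>"

(* Topological genus: the first integral homology group is free abelian of rank 2g. *)
definition has_genus :: "'p topology \<Rightarrow> nat \<Rightarrow> bool" where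
  "has_genus X g \<longleftrightarrow> homology_group 1 X \<cong> free_Abelian_group {..<2 * g}"

(* A local coordinate need not belong to the given atlas; it only has to be
   holomorphically compatible with it. *)
definition local_coordinate_at ::
  "'p topology \<Rightarrow> 'p chart set \<Rightarrow> 'p \<Rightarrow> 'p chart \<Rightarrow> bool" where
  "local_coordinate_at X \<A> p c \<longleftrightarrow>
     complex_chart X c \<and> (\<forall>d\<in>\<A>. holomorphically_compatible c d) \<and> p \<in> fst c"

(* As in the library notion meromorphic_on, values at the (isolated) poles are
   irrelevant. *)
definition surface_meromorphic :: "'p chart set \<Rightarrow> ('p \<Rightarrow> complex) \<Rightarrow> bool" where
  "surface_meromorphic \<A> f \<longleftrightarrow>
     (\<forall>(U, \<phi>)\<in>\<A>. (f \<circ> inv_into U \<phi>) meromorphic_on (\<phi> ` U))"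

(* Intended for open sets S. *)
definition surface_holomorphic_on :: "'p chart set \<Rightarrow> ('p \<Rightarrow> complex) \<Rightarrow> 'p set \<Rightarrow> bool" where
  "surface_holomorphic_on \<A> f S \<longleftrightarrow>
     (\<forall>(U, \<phi>)\<in>\<A>. (f \<circ> inv_into U \<phi>) holomorphic_on (\<phi> ` (U \<inter> S)))"

(* The local condition at a weak singularity p with vector a, in the local
   coordinate c. F i j is the Laurent series of the (i,j) entry of L in the
   variable z - z(p); the residue is required to be the outer product a b^t
   with b^t a = 0. *)
definition tyurin_condition ::
  "'p chart \<Rightarrow> 'p \<Rightarrow> complex ^ 'n \<Rightarrow> ('p \<Rightarrow> complex ^ 'n ^ 'n) \<Rightarrow> bool" where
  "tyurin_condition c p a L \<longleftrightarrow> (case c of (U, \<phi>) \<Rightarrow>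
     (\<exists>F :: 'n \<Rightarrow> 'n \<Rightarrow> complex fls.
        (\<forall>i j. (\<lambda>w. L (inv_into U \<phi> (\<phi> p + w)) $ i $ j) has_laurent_expansion F i j) \<and>
        (\<forall>i j. \<forall>k < -1. fls_nth (F i j) k = 0) \<and>
        (\<exists>b :: complex ^ 'n.
           (\<chi> i j. fls_nth (F i j) (-1)) = (\<chi> i j. a $ i * b $ j) \<and>
           (\<Sum>i\<in>UNIV. b $ i * a $ i) = 0) \<and>
        (\<exists>\<kappa> :: complex. (\<chi> i j. fls_nth (F i j) 0) *v a = \<kappa> *s a)))"

definition lax_operator ::
  "'p topology \<Rightarrow> 'p chart set \<Rightarrow> 'p \<Rightarrow> 'p \<Rightarrow> 's set \<Rightarrow> ('s \<Rightarrow> 'p) \<Rightarrow> ('s \<Rightarrow> complex ^ 'n) \<Rightarrow>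
   ('s \<Rightarrow> 'p chart) \<Rightarrow> ('p \<Rightarrow> complex ^ 'n ^ 'n) \<Rightarrow> bool" where
  "lax_operator X \<A> P\<^sub>p P\<^sub>m I \<gamma> \<alpha> z L \<longleftrightarrow>
     (\<forall>i j. surface_meromorphic \<A> (\<lambda>p. L p $ i $ j)) \<and>
     (\<forall>i j. surface_holomorphic_on \<A> (\<lambda>p. L p $ i $ j) (topspace X - ({P\<^sub>p, P\<^sub>m} \<union> \<gamma> ` I))) \<and>
     (\<forall>s\<in>I. tyurin_condition (z s) (\<gamma> s) (\<alpha> s) L)"

end

theory Submission
  imports Defs
begin

text \<open>
  Write \<open>A\<^sub>k\<close>, \<open>B\<^sub>k\<close> for the Laurent coefficients of the two factors, so that
  \<open>A\<^sub>-\<^sub>1 = a b\<^sup>t\<close>, \<open>B\<^sub>-\<^sub>1 = a c\<^sup>t\<close>, \<open>A\<^sub>0 a = \<kappa> a\<close>, \<open>B\<^sub>0 a = \<mu> a\<close> and \<open>b\<^sup>t a = c\<^sup>t a = 0\<close>.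
  The double pole \<open>A\<^sub>-\<^sub>1 B\<^sub>-\<^sub>1 = a (b\<^sup>t a) c\<^sup>t\<close> vanishes; the residue is
  \<open>A\<^sub>-\<^sub>1 B\<^sub>0 + A\<^sub>0 B\<^sub>-\<^sub>1 = a (b\<^sup>t B\<^sub>0 + \<kappa> c\<^sup>t)\<close>, and \<open>b\<^sup>t B\<^sub>0 a + \<kappa> c\<^sup>t a = \<mu> b\<^sup>t a + \<kappa> c\<^sup>t a = 0\<close>;
  finally \<open>(A\<^sub>-\<^sub>1 B\<^sub>1 + A\<^sub>0 B\<^sub>0 + A\<^sub>1 B\<^sub>-\<^sub>1) a = (b\<^sup>t B\<^sub>1 a + \<kappa> \<mu>) a\<close>.
\<close>

text \<open>Terms outside the subdegree range vanish. Bounds not tied to subdegrees let one index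
  range serve all entries of a matrix of series.\<close>

lemma fls_times_nth_bounded:
  fixes f g :: "'a :: semiring_0 fls"
  assumes "\<And>k. k < l \<Longrightarrow> fls_nth f k = 0" and "\<And>k. k < m \<Longrightarrow> fls_nth g k = 0"
  shows "fls_nth (f * g) n = (\<Sum>k=l..n - m. fls_nth f k * fls_nth g (n - k))"
\<comment> \<open>By convention \<open>fls_subdegree 0 = 0\<close>, which may lie below
  \<open>l\<close> or \<open>m\<close>.\<close>
proof (cases "f = 0 \<or> g = 0")
  case False
  then have "l \<le> fls_subdegree f" "m \<le> fls_subdegree g"
    using assms by (auto intro: fls_subdegree_geI)
  then show ?thesis
    unfolding fls_times_nth(2)
    by (intro sum.mono_neutral_left) (auto simp: not_le)
qed auto

definition outer :: "'a :: times ^ 'n \<Rightarrow> 'a ^ 'm \<Rightarrow> 'a ^ 'm ^ 'n" where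
  "outer a b = (\<chi> i j. a $ i * b $ j)"

text \<open>The bilinear pairing b^t a, without conjugation; not the real-valued
  \<open>inner\<close>.\<close>

definition dot :: "'a :: semiring_0 ^ 'n \<Rightarrow> 'a ^ 'n \<Rightarrow> 'a" where
  "dot b a = (\<Sum>i\<in>UNIV. b $ i * a $ i)"

lemma dot_add_left: "dot (b + c) a = dot b a + dot c a"
  by (simp add: dot_def distrib_right sum.distrib)

lemma dot_scale_left: "dot (k *s b) a = k * dot b a" for k :: "'a :: comm_semiring_1"
  by (simp add: dot_def sum_distrib_left mult.assoc)

lemma dot_scale_right: "dot b (k *s a) = k * dot b a" for k :: "'a :: comm_semiring_1"
  by (simp add: dot_def sum_distrib_left ac_simps)

text \<open>Associativity of b^t M a. It moves \<open>M\<close> from the new residue covector onto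
  \<open>a\<close>, where the eigenvector condition applies.\<close>

lemma dot_vector_matrix_mult: "dot (b v* M) a = dot b (M *v a)"
  for M :: "'a :: comm_semiring_1 ^ 'n ^ 'm"
  unfolding dot_def vector_matrix_mult_def matrix_vector_mult_def
  by (simp add: sum_distrib_left sum_distrib_right ac_simps) (rule sum.swap)

lemma outer_mult_vector: "outer a b *v x = dot b x *s a" for a :: "'a :: comm_semiring_1 ^ 'n"
  by (simp add: outer_def dot_def matrix_vector_mult_def vec_eq_iff sum_distrib_left ac_simps)

lemma outer_mult_matrix: "outer a b ** M = outer a (b v* M)"
  for M :: "'a :: comm_semiring_1 ^ 'n ^ 'm"
  by (simp add: outer_def matrix_matrix_mult_def vector_matrix_mult_def vec_eq_iff
      sum_distrib_left ac_simps)

lemma matrix_mult_outer: "M ** outer a b = outer (M *v a) b"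
  for M :: "'a :: comm_semiring_1 ^ 'n ^ 'm"
  by (simp add: outer_def matrix_matrix_mult_def matrix_vector_mult_def vec_eq_iff
      sum_distrib_left ac_simps)

lemma outer_scale_left: "outer (k *s a) b = outer a (k *s b)" for k :: "'a :: comm_semiring_1"
  by (simp add: outer_def vec_eq_iff ac_simps)

lemma outer_add_right: "outer a b + outer a c = outer a (b + c)" for a :: "'a :: semiring_0 ^ 'n"
  by (simp add: outer_def vec_eq_iff distrib_left)

definition coeff_matrix :: "('m \<Rightarrow> 'n \<Rightarrow> 'a :: zero fls) \<Rightarrow> int \<Rightarrow> 'a ^ 'n ^ 'm" where
  "coeff_matrix F k = (\<chi> i j. fls_nth (F i j) k)"

text \<open>The Cauchy product for matrices of series: with bounds common to all entries, the sum
  over degrees commutes with the sum over \<open>r\<close>.\<close>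

lemma coeff_matrix_mult:
  fixes F :: "'m :: finite \<Rightarrow> 'n :: finite \<Rightarrow> 'a :: semiring_1 fls"
    and G :: "'n \<Rightarrow> 'p :: finite \<Rightarrow> 'a fls"
  assumes "\<And>i j k. k < l \<Longrightarrow> fls_nth (F i j) k = 0"
    and "\<And>i j k. k < m \<Longrightarrow> fls_nth (G i j) k = 0"
  shows "coeff_matrix (\<lambda>i j. \<Sum>r\<in>UNIV. F i r * G r j) n =
    (\<Sum>k=l..n - m. coeff_matrix F k ** coeff_matrix G (n - k))"
  by (simp add: coeff_matrix_def vec_eq_iff matrix_matrix_mult_def fls_nth_sum
      fls_times_nth_bounded[OF assms] sum.swap[where A = UNIV])

lemma tyurin_condition_iff:
  "tyurin_condition (U, \<phi>) p a L \<longleftrightarrow>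
    (\<exists>F. (\<forall>i j. (\<lambda>w. L (inv_into U \<phi> (\<phi> p + w)) $ i $ j) has_laurent_expansion F i j) \<and>
      (\<forall>i j. \<forall>k < -1. fls_nth (F i j) k = 0) \<and>
      (\<exists>b. coeff_matrix F (-1) = outer a b \<and> dot b a = 0) \<and>
      (\<exists>\<kappa>. coeff_matrix F 0 *v a = \<kappa> *s a))"
  by (simp add: tyurin_condition_def coeff_matrix_def outer_def dot_def)

lemma tyurin_condition_mult:
  fixes a :: "complex ^ 'n"
  assumes "tyurin_condition c p a L" and "tyurin_condition c p a M"
  shows "tyurin_condition c p a (\<lambda>q. L q ** M q)"
proof -
  obtain U \<phi> where c: "c = (U, \<phi>)"
    by (cases c)
  obtain F b \<kappa> where F: "\<And>i j. (\<lambda>w. L (inv_into U \<phi> (\<phi> p + w)) $ i $ j) has_laurent_expansion F i j"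
    and F_pole: "\<And>i j k. k < -1 \<Longrightarrow> fls_nth (F i j) k = 0"
    and F_res: "coeff_matrix F (-1) = outer a b" and b: "dot b a = 0"
    and F_eig: "coeff_matrix F 0 *v a = \<kappa> *s a"
    using assms(1) unfolding c tyurin_condition_iff by blast
  obtain G d \<mu> where G: "\<And>i j. (\<lambda>w. M (inv_into U \<phi> (\<phi> p + w)) $ i $ j) has_laurent_expansion G i j"
    and G_pole: "\<And>i j k. k < -1 \<Longrightarrow> fls_nth (G i j) k = 0"
    and G_res: "coeff_matrix G (-1) = outer a d" and d: "dot d a = 0"
    and G_eig: "coeff_matrix G 0 *v a = \<mu> *s a"
    using assms(2) unfolding c tyurin_condition_iff by blast
  define H where "H = (\<lambda>i j. \<Sum>r\<in>UNIV. F i r * G r j)"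
  have H_nth: "coeff_matrix H n = (\<Sum>k=-1..n + 1. coeff_matrix F k ** coeff_matrix G (n - k))" for n
    using coeff_matrix_mult[of "-1" F "-1" G n] F_pole G_pole unfolding H_def by simp
  have H: "(\<lambda>w. (L (inv_into U \<phi> (\<phi> p + w)) ** M (inv_into U \<phi> (\<phi> p + w))) $ i $ j)
      has_laurent_expansion H i j" for i j
    unfolding H_def matrix_matrix_mult_def
    by (simp, intro laurent_expansion_intros F G)
  have H_double: "coeff_matrix H (-2) = 0"
    by (simp add: H_nth F_res G_res outer_mult_matrix matrix_mult_outer outer_mult_vector b)
       (simp add: outer_def vec_eq_iff)
  have H_pole: "fls_nth (H i j) k = 0" if "k < -1" for i j k
  proof -
    have "k = -2 \<or> k < -2"
      using that by linarith
    \<comment> \<open>For \<open>k < -2\<close> the range \<open>{-1..k + 1}\<close> in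
      \<open>H_nth\<close> is empty.\<close>
    then have "coeff_matrix H k = 0"
      using H_double by (auto simp: H_nth)
    then show ?thesis
      by (simp add: coeff_matrix_def vec_eq_iff)
  qed
  have ivl: "{-1..0} = {-1, 0 :: int}" "{-1..1} = {-1, 0, 1 :: int}"
    by auto
  \<comment> \<open>In the term \<open>coeff_matrix F 0 ** outer a d\<close> the eigenvalue \<kappa>
    passes from \<open>a\<close> to \<open>d\<close>, so both terms share the left factor
    \<open>a\<close>.\<close>
  have H_res: "coeff_matrix H (-1) = outer a (b v* coeff_matrix G 0 + \<kappa> *s d)"
    by (simp add: H_nth ivl F_res G_res outer_mult_matrix matrix_mult_outer F_eig
        outer_scale_left outer_add_right)
  have H_tr: "dot (b v* coeff_matrix G 0 + \<kappa> *s d) a = 0"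
    by (simp add: dot_add_left dot_scale_left dot_scale_right dot_vector_matrix_mult G_eig b d)
  have "coeff_matrix H 0 *v a = coeff_matrix F (-1) *v (coeff_matrix G 1 *v a)
      + coeff_matrix F 0 *v (coeff_matrix G 0 *v a) + coeff_matrix F 1 *v (coeff_matrix G (-1) *v a)"
    by (simp add: H_nth ivl matrix_vector_mult_add_rdistrib matrix_vector_mul_assoc)
  \<comment> \<open>The unconstrained \<open>coeff_matrix G 1\<close> enters only through a scalar,
    and \<open>coeff_matrix F 1\<close> acts on \<open>dot d a *s a = 0\<close>.\<close>
  also have "\<dots> = (dot b (coeff_matrix G 1 *v a) + \<mu> * \<kappa>) *s a"
    by (simp add: F_res G_res F_eig G_eig outer_mult_vector d vector_scalar_commute
        vector_sadd_rdistrib vector_smult_assoc)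
  finally have H_eig: "coeff_matrix H 0 *v a = \<dots>" .
  show ?thesis
    unfolding c tyurin_condition_iff
    using H H_pole H_res H_tr H_eig by blast
qed

theorem lemma2p1:
  fixes X :: "'p topology" and \<A> :: "'p chart set" and g :: nat
    and P\<^sub>p P\<^sub>m :: 'p
    and \<gamma> :: "nat \<Rightarrow> 'p" and \<alpha> :: "nat \<Rightarrow> complex ^ 'n" and z :: "nat \<Rightarrow> 'p chart"
    and L' L'' :: "'p \<Rightarrow> complex ^ 'n ^ 'n"
  assumes "compact_riemann_surface X \<A>"
    and "has_genus X g"
    and "P\<^sub>p \<in> topspace X" and "P\<^sub>m \<in> topspace X" and "P\<^sub>p \<noteq> P\<^sub>m"
    and "\<gamma> ` {1..CARD('n) * g} \<subseteq> topspace X - {P\<^sub>p, P\<^sub>m}"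
    and "inj_on \<gamma> {1..CARD('n) * g}"
    and "\<And>s. s \<in> {1..CARD('n) * g} \<Longrightarrow> \<alpha> s \<noteq> 0"
    and "\<And>s. s \<in> {1..CARD('n) * g} \<Longrightarrow> local_coordinate_at X \<A> (\<gamma> s) (z s)"
    and "lax_operator X \<A> P\<^sub>p P\<^sub>m {1..CARD('n) * g} \<gamma> \<alpha> z L'"
    and "lax_operator X \<A> P\<^sub>p P\<^sub>m {1..CARD('n) * g} \<gamma> \<alpha> z L''"
  shows "\<forall>s\<in>{1..CARD('n) * g}. tyurin_condition (z s) (\<gamma> s) (\<alpha> s) (\<lambda>p. L' p ** L'' p)"
  using assms(10,11) by (auto simp: lax_operator_def intro: tyurin_condition_mult)

end
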